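(* Let $A\in\mathbb{R}^{n\times m}$. If $\mathcal{Q}^{2r}(A)\subseteq\mathbf{P_0}$ for each $r\in\mathbb{N}$, then $\mathcal{Q}^{2r}(A)\subseteq\mathbf{PS}$ for each $r\in\mathbb{N}$.
   Context: $\mathcal{Q}(A)$: real matrices with the same sign pattern as $A$; $\mathcal{Q}^{2r}(A)=\{A_1A_2^{\mathrm t}\cdots A_{2r-1}A_{2r}^{\mathrm t}\colon A_i\in\mathcal{Q}(A)\}$. $\mathbf{P_0}$: real square matrices all of whose principal minors are nonnegative; $\mathbf{PS}$: real square matrices all of whose eigenvalues are real and nonnegative. *)

theory Defs
  imports
    Complex_Main
    "Jordan_Normal_Form.Determinant"
    "Jordan_Normal_Form.Char_Poly"
    "Jordan_Normal_Form.DL_Submatrix"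
begin

definition sign_class :: "real mat \<Rightarrow> real mat set" where
  "sign_class A = {B \<in> carrier_mat (dim_row A) (dim_col A).
     \<forall>i < dim_row A. \<forall>j < dim_col A. sgn (B $$ (i, j)) = sgn (A $$ (i, j))}"

text \<open>For matrices \<open>F i\<close> with \<open>n\<close> rows, \<open>alternating_prod n F r\<close> is
  \<open>F 1 * (F 2)\<^sup>T * \<dots> * F (2 * r - 1) * (F (2 * r))\<^sup>T\<close>.\<close>

primrec alternating_prod :: "nat \<Rightarrow> (nat \<Rightarrow> real mat) \<Rightarrow> nat \<Rightarrow> real mat" where
  "alternating_prod n F 0 = 1\<^sub>m n"
| "alternating_prod n F (Suc r) =
     alternating_prod n F r * (F (2 * r + 1) * transpose_mat (F (2 * r + 2)))"

definition sign_class_power :: "real mat \<Rightarrow> nat \<Rightarrow> real mat set" where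
  "sign_class_power A r =
     {alternating_prod (dim_row A) F r | F. \<forall>i \<in> {1..2 * r}. F i \<in> sign_class A}"

definition P0_matrices :: "real mat set" where
  "P0_matrices = {M. square_mat M \<and>
     (\<forall>I. I \<subseteq> {..<dim_row M} \<and> I \<noteq> {} \<longrightarrow> det (submatrix M I I) \<ge> 0)}"

text \<open>The eigenvalues of a real matrix are its complex eigenvalues, hence the embedding into
  complex matrices; quantifying over real eigenvalues only would lose the reality requirement.\<close>

definition PS_matrices :: "real mat set" where
  "PS_matrices = {M. square_mat M \<and>
     (\<forall>z. eigenvalue (map_mat complex_of_real M) z \<longrightarrow> z \<in> \<real> \<and> Re z \<ge> 0)}"

end

theory Submission
  imports "HOL-Analysis.Complex_Transcendental" Defs
begin

text \<open>
  Write \<open>det (M + x I) = \<Sum>k\<le>n. e k * x ^ k\<close>; the coefficients are sums of principal minors, hence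
  nonnegative for a \<open>P\<^sub>0\<close> matrix, and so (Kellogg) no root \<open>x\<close> has \<open>0 < \<bar>arg x\<bar> < \<pi> / n\<close>. All powers of
  a matrix in \<open>sign_class_power A r\<close> are \<open>P\<^sub>0\<close>, and a number \<open>z\<close> with \<open>0 < \<bar>arg z\<bar> < \<pi> / (n + 1)\<close> has a power close to
  the negative axis; thus an eigenvalue that is not a nonnegative real stays outside a fixed sector
  around the positive axis.

  Changing one entry of one factor changes the product by a matrix of rank one, so each \<open>e k\<close> is
  affine in every entry of every factor. Being nonnegative on an open orthant, it vanishes either
  everywhere or nowhere there. Hence, along the segment from \<open>(A A\<^sup>T)\<^sup>r\<close>, whose eigenvalues are real
  and nonnegative, to a given product, the number of nonzero eigenvalues is constant: no
  eigenvalue can pass through \<open>0\<close>, nor can it cross the sector, so none leaves the nonnegative axis.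
\<close>

subsection \<open>Coefficients of the characteristic polynomial\<close>

text \<open>Putting unit rows in place of deleted ones keeps the size \<open>n\<close> for minors of
  every order. The Leibniz formula, continuity and rank-one arguments then need no reindexing; only
  \<open>det_unit_rows\<close> deals with \<open>submatrix\<close>.\<close>

definition unit_rows :: "nat \<Rightarrow> 'a :: comm_ring_1 mat \<Rightarrow> nat set \<Rightarrow> 'a mat" where
  "unit_rows n M S = mat n n (\<lambda>(i, j). if i \<in> S then (if i = j then 1 else 0) else M $$ (i, j))"

text \<open>The determinant of \<open>unit_rows n M S\<close> is the principal minor of \<open>M\<close> on the complement of \<open>S\<close>, so
  \<open>minor_sum n k\<close> adds up the principal minors of order \<open>n - k\<close>.\<close>

definition minor_sum :: "nat \<Rightarrow> nat \<Rightarrow> 'a :: comm_ring_1 mat \<Rightarrow> 'a" where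
  "minor_sum n k M = (\<Sum>S | S \<subseteq> {0..<n} \<and> card S = k. det (unit_rows n M S))"

lemma permutes_atLeastLessThan_less:
  fixes n :: nat
  shows "p permutes {0..<n} \<Longrightarrow> i < n \<Longrightarrow> p i < n"
  using permutes_in_image[of p "{0..<n}" i] by simp

text \<open>Expand each Leibniz product over the set \<open>S\<close> of rows that contribute the
  diagonal term \<open>x\<close>. A row in \<open>S\<close> survives only if the permutation fixes
  it, which is exactly what a unit row enforces.\<close>

lemma det_add_scalar:
  fixes M :: "'a :: comm_ring_1 mat"
  assumes M: "M \<in> carrier_mat n n"
  shows "det (M + x \<cdot>\<^sub>m 1\<^sub>m n) = (\<Sum>k\<le>n. minor_sum n k M * x ^ k)"
proof -
  let ?P = "{p. p permutes {0..<n}}"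
  have "det (M + x \<cdot>\<^sub>m 1\<^sub>m n) =
      (\<Sum>p\<in>?P. signof p * (\<Prod>i = 0..<n. (if i = p i then x else 0) + M $$ (i, p i)))"
    using M by (subst det_def'[of _ n])
      (auto intro!: sum.cong prod.cong arg_cong[where f = "(*) _"] simp: permutes_atLeastLessThan_less)
  also have "\<dots> = (\<Sum>p\<in>?P. \<Sum>S\<in>Pow {0..<n}.
      x ^ card S * (signof p * (\<Prod>i = 0..<n. unit_rows n M S $$ (i, p i))))"
  proof (rule sum.cong[OF refl])
    fix p assume p: "p \<in> ?P"
    have "(\<Prod>i\<in>S. if i = p i then x else 0) * (\<Prod>i\<in>{0..<n} - S. M $$ (i, p i)) =
        x ^ card S * (\<Prod>i = 0..<n. unit_rows n M S $$ (i, p i))" if S: "S \<subseteq> {0..<n}" for S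
    proof -
      have "finite S" using S finite_subset by blast
      have "(\<Prod>i\<in>S. if i = p i then x else 0) = (\<Prod>i\<in>S. x * (if i = p i then 1 else 0))"
        by (rule prod.cong) auto
      also have "\<dots> = x ^ card S * (\<Prod>i\<in>S. if i = p i then 1 else 0)"
        by (simp add: prod.distrib)
      also have "(\<Prod>i\<in>S. if i = p i then 1 else 0) = (\<Prod>i\<in>S. unit_rows n M S $$ (i, p i))"
        using S p by (intro prod.cong) (auto simp: unit_rows_def permutes_atLeastLessThan_less)
      finally have 1: "(\<Prod>i\<in>S. if i = p i then x else 0) =
        x ^ card S * (\<Prod>i\<in>S. unit_rows n M S $$ (i, p i))" .
      have 2: "(\<Prod>i\<in>{0..<n} - S. M $$ (i, p i)) = (\<Prod>i\<in>{0..<n} - S. unit_rows n M S $$ (i, p i))"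
        using S p by (intro prod.cong) (auto simp: unit_rows_def permutes_atLeastLessThan_less)
      show ?thesis
        unfolding 1 2 using prod.subset_diff[OF S, of "\<lambda>i. unit_rows n M S $$ (i, p i)"]
        by (simp add: ac_simps)
    qed
    then show "signof p * (\<Prod>i = 0..<n. (if i = p i then x else 0) + M $$ (i, p i)) =
       (\<Sum>S\<in>Pow {0..<n}. x ^ card S * (signof p * (\<Prod>i = 0..<n. unit_rows n M S $$ (i, p i))))"
      by (subst prod_add) (auto simp: sum_distrib_left ac_simps intro!: sum.cong)
  qed
  also have "\<dots> = (\<Sum>S\<in>Pow {0..<n}. x ^ card S * det (unit_rows n M S))"
    by (subst sum.swap) (simp add: det_def'[of _ n] unit_rows_def sum_distrib_left)
  also have "\<dots> = (\<Sum>k\<le>n. \<Sum>S | S \<in> Pow {0..<n} \<and> card S = k. x ^ card S * det (unit_rows n M S))"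
    by (rule sum.group[symmetric])
       (auto intro: subset_eq_atLeast0_lessThan_card)
  also have "\<dots> = (\<Sum>k\<le>n. minor_sum n k M * x ^ k)"
    by (intro sum.cong) (auto simp: minor_sum_def sum_distrib_left ac_simps)
  finally show ?thesis .
qed

lemma minor_sum_top: "minor_sum n n M = 1"
proof -
  have "{S. S \<subseteq> {0..<n} \<and> card S = n} = {{0..<n}}"
    using card_subset_eq[of "{0..<n}"] by auto
  moreover have "unit_rows n M {0..<n} = 1\<^sub>m n"
    by (auto simp: unit_rows_def)
  ultimately show ?thesis
    by (simp add: minor_sum_def)
qed

lemma minor_sum_of_real:
  assumes "M \<in> carrier_mat n n"
  shows "minor_sum n k (map_mat complex_of_real M) = of_real (minor_sum n k M)"
proof -
  have "unit_rows n (map_mat complex_of_real M) S = map_mat of_real (unit_rows n M S)" for S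
    using assms by (auto simp: unit_rows_def)
  then show ?thesis
    by (simp add: minor_sum_def of_real_hom.hom_det)
qed

text \<open>A unit row annihilates every permutation that moves its index, so only permutations of
  the complement of \<open>S\<close> remain in the Leibniz sum. Renumbering the complement in
  increasing order turns this into the Leibniz sum of the submatrix.\<close>

lemma det_unit_rows:
  fixes M :: "'a :: comm_ring_1 mat"
  assumes M: "M \<in> carrier_mat n n" and S: "S \<subseteq> {0..<n}"
  shows "det (unit_rows n M S) = det (submatrix M ({0..<n} - S) ({0..<n} - S))"
proof -
  define I where "I = {0..<n} - S"
  define d where "d = card I"
  have I: "I \<subseteq> {0..<n}" by (auto simp: I_def)
  have Ieq: "{i. i < n \<and> i \<in> I} = I" using I by auto
  have fin: "finite I" using I finite_subset by blast
  have inj: "inj_on (pick I) {0..<d}"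
  proof (rule linorder_inj_onI)
    fix a b assume "a < b" "a \<in> {0..<d}" "b \<in> {0..<d}"
    then show "pick I a \<noteq> pick I b"
      using pick_mono[of b I a] by (auto simp: d_def)
  qed auto
  have "pick I ` {0..<d} \<subseteq> I"
    using pick_in_set[of _ I] by (auto simp: d_def)
  then have bij: "bij_betw (pick I) {0..<d} I"
    using inj fin card_subset_eq[of I "pick I ` {0..<d}"]
    by (auto simp: bij_betw_def card_image d_def)
  have sub: "submatrix M I I = mat d d (\<lambda>(i, j). M $$ (pick I i, pick I j))"
    using M by (simp add: submatrix_def Ieq d_def)
  let ?f = "\<lambda>p. signof p * (\<Prod>i = 0..<n. unit_rows n M S $$ (i, p i))"
  have "det (unit_rows n M S) = sum ?f {p. p permutes {0..<n}}"
    by (rule det_def') (simp add: unit_rows_def)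
  also have "\<dots> = sum ?f {p. p permutes I}"
  proof (rule sum.mono_neutral_right)
    show "finite {p. p permutes {0..<n}}" by (simp add: finite_permutations)
    show "{p. p permutes I} \<subseteq> {p. p permutes {0..<n}}"
      using I permutes_subset by blast
    show "\<forall>p\<in>{p. p permutes {0..<n}} - {p. p permutes I}. ?f p = 0"
    proof
      fix p assume p: "p \<in> {p. p permutes {0..<n}} - {p. p permutes I}"
      then have pn: "p permutes {0..<n}" by simp
      then obtain i where i: "i \<in> {0..<n}" "i \<notin> I" "p i \<noteq> i"
        using p permutes_superset[of p "{0..<n}" I] by auto
      then have "i \<in> S" by (auto simp: I_def)
      then have "unit_rows n M S $$ (i, p i) = 0"
        using i pn by (auto simp: unit_rows_def permutes_atLeastLessThan_less)
      then have "(\<Prod>i = 0..<n. unit_rows n M S $$ (i, p i)) = 0"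
        using i by (intro prod_zero) auto
      then show "?f p = 0" by simp
    qed
  qed
  also have "\<dots> = (\<Sum>p | p permutes I. signof p * (\<Prod>i\<in>I. M $$ (i, p i)))"
  proof (rule sum.cong[OF refl])
    fix p assume "p \<in> {p. p permutes I}"
    then have p: "p permutes I" by simp
    then have pn: "p permutes {0..<n}" using I permutes_subset by blast
    have "(\<Prod>i = 0..<n. unit_rows n M S $$ (i, p i)) = (\<Prod>i\<in>I. unit_rows n M S $$ (i, p i))"
      using p S by (intro prod.mono_neutral_right)
        (auto simp: I_def unit_rows_def permutes_not_in)
    also have "\<dots> = (\<Prod>i\<in>I. M $$ (i, p i))"
      using pn by (intro prod.cong) (auto simp: I_def unit_rows_def permutes_atLeastLessThan_less)
    finally show "?f p = signof p * (\<Prod>i\<in>I. M $$ (i, p i))" by simp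
  qed
  also have "\<dots> = (\<Sum>p | p permutes {0..<d}. signof p * (\<Prod>i = 0..<d. M $$ (pick I i, pick I (p i))))"
  proof -
    \<comment> \<open>Conjugation with the enumeration \<open>pick I\<close> matches the two sets of
      permutations; it preserves signs.\<close>
    have bijp: "bij_betw (map_permutation {0..<d} (pick I)) {p. p permutes {0..<d}} {p. p permutes I}"
    proof (rule bij_betw_byWitness[where f' = "map_permutation I (inv_into {0..<d} (pick I))"])
      note b' = bij_betw_inv_into[OF bij]
      show "map_permutation {0..<d} (pick I) ` {p. p permutes {0..<d}} \<subseteq> {p. p permutes I}"
        using map_permutation_permutes[OF bij] by auto
      show "map_permutation I (inv_into {0..<d} (pick I)) ` {p. p permutes I} \<subseteq> {p. p permutes {0..<d}}"
        using map_permutation_permutes[OF b'] by auto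
      show "\<forall>p\<in>{p. p permutes {0..<d}}. map_permutation I (inv_into {0..<d} (pick I))
          (map_permutation {0..<d} (pick I) p) = p"
        using bij by (auto intro!: map_permutation_compose_inv simp: bij_betw_inv_into_left)
      show "\<forall>p\<in>{p. p permutes I}. map_permutation {0..<d} (pick I)
          (map_permutation I (inv_into {0..<d} (pick I)) p) = p"
        using b' bij by (auto intro!: map_permutation_compose_inv simp: bij_betw_inv_into_right)
    qed
    show ?thesis
    proof (rule sum.reindex_bij_betw[OF bijp, symmetric, THEN trans], rule sum.cong[OF refl])
      fix p assume "p \<in> {p. p permutes {0..<d}}"
      then have p: "p permutes {0..<d}" by simp
      have "(\<Prod>i\<in>I. M $$ (i, map_permutation {0..<d} (pick I) p i)) =
        (\<Prod>i = 0..<d. M $$ (pick I i, map_permutation {0..<d} (pick I) p (pick I i)))"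
        by (rule prod.reindex_bij_betw[OF bij, symmetric])
      also have "\<dots> = (\<Prod>i = 0..<d. M $$ (pick I i, pick I (p i)))"
        using inj by (intro prod.cong) (auto simp: map_permutation_apply)
      finally show "signof (map_permutation {0..<d} (pick I) p) *
          (\<Prod>i\<in>I. M $$ (i, map_permutation {0..<d} (pick I) p i)) =
          signof p * (\<Prod>i = 0..<d. M $$ (pick I i, pick I (p i)))"
        using sign_map_permutation[OF inj p] by simp
    qed
  qed
  also have "\<dots> = det (submatrix M I I)"
    unfolding sub by (subst det_def'[of _ d])
      (auto intro!: sum.cong prod.cong arg_cong[where f = "(*) _"] simp: permutes_atLeastLessThan_less)
  finally show ?thesis by (simp add: I_def)
qed

lemma minor_sum_nonneg:
  assumes "M \<in> P0_matrices" "M \<in> carrier_mat n n"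
  shows "minor_sum n k M \<ge> 0"
  unfolding minor_sum_def
proof (rule sum_nonneg)
  fix S assume S: "S \<in> {S. S \<subseteq> {0..<n} \<and> card S = k}"
  show "det (unit_rows n M S) \<ge> 0"
  \<comment> \<open>The empty minor is not covered by \<open>P0_matrices\<close>; here it is the
    determinant of the identity.\<close>
  proof (cases "S = {0..<n}")
    case True
    then have "unit_rows n M S = 1\<^sub>m n" by (auto simp: unit_rows_def)
    then show ?thesis by simp
  next
    case False
    then have "{0..<n} - S \<noteq> {}" "{0..<n} - S \<subseteq> {..<dim_row M}"
      using S assms by auto
    then show ?thesis
      using assms S det_unit_rows[of M n S] by (auto simp: P0_matrices_def)
  qed
qed

text \<open>By a Schur complement the determinant equals that of a bordered matrix in which \<open>s\<close> occurs only
  in the first column.\<close>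

lemma det_rank_one_update:
  fixes B :: "'a :: idom mat"
  assumes B: "B \<in> carrier_mat n n"
  shows "\<exists>a b. \<forall>s. det (mat n n (\<lambda>(i, j). B $$ (i, j) + s * (x i * y j))) = a + b * s"
proof -
  define C where "C s = four_block_mat (1\<^sub>m 1) (mat 1 n (\<lambda>(i, j). y j)) (mat n 1 (\<lambda>(i, j). - s * x i)) B" for s
  define R where "R s = mat n n (\<lambda>(i, j). B $$ (i, j) + s * (x i * y j))" for s
  have C: "C s \<in> carrier_mat (Suc n) (Suc n)" for s
    using B by (auto simp: C_def)
  have detC: "det (C s) = det (R s)" for s
  proof -
    define L where "L = four_block_mat (1\<^sub>m 1) (0\<^sub>m 1 n) (mat n 1 (\<lambda>(i, j). - s * x i)) (1\<^sub>m n)"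
    define U where "U = four_block_mat (1\<^sub>m 1) (mat 1 n (\<lambda>(i, j). y j)) (0\<^sub>m n 1) (R s)"
    have "C s = L * U"
      unfolding L_def U_def C_def
      by (subst mult_four_block_mat[of _ 1 1 _ n _ n _ _ 1 _ n])
         (use B in \<open>auto simp: R_def scalar_prod_def intro!: arg_cong[where f = "four_block_mat _ _ _"]\<close>)
    moreover have "det L = 1" "det U = det (R s)"
      unfolding L_def U_def
      by (subst det_four_block_mat_upper_right_zero[of _ 1 _ n] det_four_block_mat_lower_left_zero[of _ 1 _ n],
          auto simp: R_def)+
    moreover have "L \<in> carrier_mat (Suc n) (Suc n)" "U \<in> carrier_mat (Suc n) (Suc n)"
      by (auto simp: L_def U_def R_def)
    ultimately show ?thesis by (simp add: det_mult)
  qed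
  \<comment> \<open>Deleting the first column removes every occurrence of \<open>s\<close>, so
    expansion along that column is affine in \<open>s\<close>.\<close>
  have cof: "cofactor (C s) i 0 = cofactor (C 0) i 0" if "i < Suc n" for i s
  proof -
    have "mat_delete (C s) i 0 = mat_delete (C 0) i 0"
      using B that by (intro eq_matI) (auto simp: mat_delete_def C_def)
    then show ?thesis by (simp add: cofactor_def)
  qed
  have "det (R s) = cofactor (C 0) 0 0 + (\<Sum>i<n. - x i * cofactor (C 0) (Suc i) 0) * s" for s
  proof -
    have "det (R s) = (\<Sum>i<Suc n. C s $$ (i, 0) * cofactor (C 0) i 0)"
      unfolding detC[symmetric] laplace_expansion_column[OF C zero_less_Suc]
      by (intro sum.cong[OF refl] arg_cong[where f = "(*) _"] cof) simp
    also have "\<dots> = cofactor (C 0) 0 0 + (\<Sum>i<n. C s $$ (Suc i, 0) * cofactor (C 0) (Suc i) 0)"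
      using B by (subst sum.lessThan_Suc_shift) (simp add: C_def)
    also have "(\<Sum>i<n. C s $$ (Suc i, 0) * cofactor (C 0) (Suc i) 0) =
       (\<Sum>i<n. - x i * cofactor (C 0) (Suc i) 0) * s"
      using B by (auto simp: C_def sum_distrib_right intro!: sum.cong)
    finally show ?thesis .
  qed
  then show ?thesis unfolding R_def by blast
qed

text \<open>Passing to unit rows only sets the entries \<open>x i\<close> with \<open>i\<close> in
  \<open>S\<close> to zero. Each summand is therefore again a determinant under a rank-one
  update.\<close>

lemma minor_sum_rank_one_update:
  fixes B :: "'a :: idom mat"
  assumes B: "B \<in> carrier_mat n n"
  shows "\<exists>a b. \<forall>s. minor_sum n k (mat n n (\<lambda>(i, j). B $$ (i, j) + s * (x i * y j))) = a + b * s"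
proof -
  define R where "R s = mat n n (\<lambda>(i, j). B $$ (i, j) + s * (x i * y j))" for s
  have "\<forall>S. \<exists>ab. \<forall>s. det (unit_rows n (R s) S) = fst ab + snd ab * s"
  proof
    fix S
    have "unit_rows n (R s) S =
        mat n n (\<lambda>(i, j). unit_rows n B S $$ (i, j) + s * ((if i \<in> S then 0 else x i) * y j))" for s
      by (auto simp: unit_rows_def R_def)
    then show "\<exists>ab. \<forall>s. det (unit_rows n (R s) S) = fst ab + snd ab * s"
      using det_rank_one_update[of "unit_rows n B S" n "\<lambda>i. if i \<in> S then 0 else x i" y]
      by (simp add: unit_rows_def)
  qed
  from choice[OF this] obtain ab
    where "\<And>S s. det (unit_rows n (R s) S) = fst (ab S) + snd (ab S) * s"
    by blast
  then have "minor_sum n k (R s) = (\<Sum>S | S \<subseteq> {0..<n} \<and> card S = k. fst (ab S)) +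
      (\<Sum>S | S \<subseteq> {0..<n} \<and> card S = k. snd (ab S)) * s" for s
    by (simp add: minor_sum_def sum.distrib sum_distrib_right)
  then show ?thesis
    unfolding R_def by blast
qed

section \<open>Continuity of the coefficients in the matrix entries\<close>

lemma continuous_on_det:
  assumes "\<And>i j. i < n \<Longrightarrow> j < n \<Longrightarrow> continuous_on T (\<lambda>t. f t i j :: real)"
  shows "continuous_on T (\<lambda>t. det (mat n n (\<lambda>(i, j). f t i j)))"
proof -
  have "det (mat n n (\<lambda>(i, j). f t i j)) =
      (\<Sum>p | p permutes {0..<n}. signof p * (\<Prod>i = 0..<n. f t i (p i)))" for t
    by (subst det_def'[of _ n])
      (auto intro!: sum.cong prod.cong arg_cong[where f = "(*) _"] simp: permutes_atLeastLessThan_less)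
  moreover have "continuous_on T (\<lambda>t. \<Sum>p | p permutes {0..<n}. signof p * (\<Prod>i = 0..<n. f t i (p i)))"
    by (intro continuous_intros assms) (auto simp: permutes_atLeastLessThan_less)
  ultimately show ?thesis by simp
qed

lemma continuous_on_minor_sum:
  assumes "\<And>i j. i < n \<Longrightarrow> j < n \<Longrightarrow> continuous_on T (\<lambda>t. M t $$ (i, j) :: real)"
  shows "continuous_on T (\<lambda>t. minor_sum n k (M t))"
  unfolding minor_sum_def unit_rows_def
proof (intro continuous_on_sum continuous_on_det)
  fix S i j assume "i < n" "j < n"
  then show "continuous_on T (\<lambda>t. if i \<in> S then if i = j then 1 else 0 else M t $$ (i, j))"
    by (cases "i \<in> S") (auto intro: assms)
qed

subsection \<open>Roots of polynomials\<close>

text \<open>Split the polynomial into linear factors: each \<open>x - a\<close> with a root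
  \<open>a\<close> has modulus at least \<open>infdist x N\<close>. The point is that this
  inequality, unlike the statement about roots, is visibly a closed condition on the
  coefficients.\<close>

lemma infdist_power_le_cmod_monic_poly:
  fixes c :: "nat \<Rightarrow> complex"
  assumes monic: "c d = 1" and roots: "\<And>x. (\<Sum>j\<le>d. c j * x ^ j) = 0 \<Longrightarrow> x \<in> N"
  shows "infdist x N ^ d \<le> cmod (\<Sum>j\<le>d. c j * x ^ j)"
proof -
  define p where "p = (\<Sum>j\<le>d. monom (c j) j)"
  have poly_p: "poly p y = (\<Sum>j\<le>d. c j * y ^ j)" for y
    by (simp add: p_def poly_sum poly_monom)
  have coeff_p: "coeff p i = (if i \<le> d then c i else 0)" for i
    by (simp add: p_def coeff_sum)
  have deg: "degree p = d"
    by (rule antisym) (auto simp: coeff_p monic intro: degree_le le_degree)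
  then have lead: "lead_coeff p = 1"
    by (simp add: coeff_p monic)
  then obtain A where A: "size A = d" "p = (\<Prod>a\<in>#A. [:- a, 1:])"
    using alg_closed_imp_factorization[of p] deg by fastforce
  have "a \<in> N" if "a \<in># A" for a
  proof -
    have "poly p a = 0"
      unfolding A(2) using that by (auto simp: poly_prod_mset)
    then show ?thesis using roots poly_p by simp
  qed
  then have "infdist x N ^ size A \<le> cmod (poly (\<Prod>a\<in>#A. [:- a, 1:]) x)"
  proof (induction A)
    case (add a A)
    have "infdist x N \<le> cmod (x - a)"
      using infdist_le[of a N x] add.prems by (simp add: dist_norm)
    moreover have "infdist x N ^ size A \<le> cmod (poly (\<Prod>a\<in>#A. [:- a, 1:]) x)"
      using add by simp
    ultimately have "infdist x N * infdist x N ^ size A \<le>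
        cmod (x - a) * cmod (poly (\<Prod>a\<in>#A. [:- a, 1:]) x)"
      by (intro mult_mono) (auto simp: infdist_nonneg)
    then show ?case by (simp add: norm_mult[symmetric] algebra_simps)
  qed simp
  then show ?thesis
    using A poly_p by simp
qed

text \<open>Outside the unit disc each lower power is at most \<open>cmod x ^ (d - 1)\<close>, so
  the leading term outweighs the other \<open>d\<close> terms once \<open>cmod x\<close> exceeds
  \<open>d * B\<close>. The bound depends only on \<open>d\<close> and \<open>B\<close>, hence
  confines all roots along a path to one ball.\<close>

lemma cmod_root_monic_poly_le:
  fixes c :: "nat \<Rightarrow> complex"
  assumes monic: "c d = 1" and bound: "\<And>j. j < d \<Longrightarrow> cmod (c j) \<le> B"
    and root: "(\<Sum>j\<le>d. c j * x ^ j) = 0"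
  shows "cmod x \<le> max 1 (real d * B)"
proof (rule ccontr)
  assume "\<not> ?thesis"
  then have x: "cmod x > 1" "cmod x > real d * B" by auto
  have "d \<noteq> 0" using root monic by (intro notI) simp
  then obtain e where d: "d = Suc e" by (cases d) auto
  have "x ^ d = - (\<Sum>j<d. c j * x ^ j)"
    using root monic by (simp add: lessThan_Suc_atMost[symmetric] eq_neg_iff_add_eq_0 add.commute)
  then have "cmod x ^ d = cmod (\<Sum>j<d. c j * x ^ j)"
    by (metis norm_minus_cancel norm_power)
  also have "\<dots> \<le> (\<Sum>j<d. B * cmod x ^ e)"
  proof (rule sum_norm_le)
    fix j assume j: "j \<in> {..<d}"
    have "cmod x ^ j \<le> cmod x ^ e"
      using x j d by (intro power_increasing) auto
    moreover have "cmod (c j) \<le> B" using bound j by simp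
    ultimately show "cmod (c j * x ^ j) \<le> B * cmod x ^ e"
      unfolding norm_mult norm_power
      by (intro mult_mono) (auto intro: order_trans[OF norm_ge_zero])
  qed
  also have "\<dots> = real d * B * cmod x ^ e" by simp
  also have "\<dots> < cmod x * cmod x ^ e"
  proof -
    have "cmod x ^ e > 0" using x(1) by (intro zero_less_power) linarith
    then show ?thesis using x(2) by (rule mult_strict_right_mono[rotated])
  qed
  finally show False by (simp add: d)
qed

text \<open>The roots could pass from \<open>N\<close> to \<open>D\<close> only through
  \<open>0\<close>, which \<open>const\<close> excludes; connectedness of the interval makes this
  rigorous without following individual roots.\<close>

lemma monic_poly_roots_path:
  fixes e :: "nat \<Rightarrow> real \<Rightarrow> real" and N D :: "complex set"
  assumes cont: "\<And>j. j \<le> d \<Longrightarrow> continuous_on {0..1} (e j)"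
    and monic: "\<And>t. t \<in> {0..1} \<Longrightarrow> e d t = 1"
    and const: "\<And>t. t \<in> {0..1} \<Longrightarrow> e 0 t \<noteq> 0"
    and "closed N" "closed D" and ND: "N \<inter> D \<subseteq> {0}" and "N \<noteq> {}"
    and roots: "\<And>t x. t \<in> {0..1} \<Longrightarrow> (\<Sum>j\<le>d. of_real (e j t) * x ^ j) = 0 \<Longrightarrow> x \<in> N \<union> D"
    and start: "\<And>x. (\<Sum>j\<le>d. of_real (e j 0) * x ^ j) = 0 \<Longrightarrow> x \<in> N"
    and "(\<Sum>j\<le>d. of_real (e j 1) * x ^ j) = 0"
  shows "x \<in> N"
proof -
  define p where "p t x = (\<Sum>j\<le>d. complex_of_real (e j t) * x ^ j)" for t x
  define T where "T = {t \<in> {0..1}. \<forall>x. p t x = 0 \<longrightarrow> x \<in> N}"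
  define U where "U = {t \<in> {0..1}. \<exists>x\<in>D. p t x = 0}"
  have "d > 0"
  proof (rule ccontr)
    assume "\<not> d > 0"
    then show False using assms(10) const[of 1] by simp
  qed
  have p0: "p t 0 \<noteq> 0" if "t \<in> {0..1}" for t
    using const[OF that] by (simp add: p_def sum.atMost_shift)
  \<comment> \<open>\<open>T\<close> is closed by continuity of roots, \<open>U\<close> because the roots stay in a compact set; as
    \<open>0\<close> is never a root, they partition the interval.\<close>
  have "closed T"
  proof -
    \<comment> \<open>For fixed \<open>x\<close> the inequality is closed in \<open>t\<close>.
      Conversely, at a root \<open>x\<close> it forces \<open>infdist x N = 0\<close>, where
      \<open>d > 0\<close> and closedness of \<open>N\<close> matter.\<close>
    have T_eq: "T = (\<Inter>x. {t \<in> {0..1}. infdist x N ^ d \<le> cmod (p t x)})"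
    proof (intro equalityI subsetI)
      fix t assume "t \<in> T"
      then show "t \<in> (\<Inter>x. {t \<in> {0..1}. infdist x N ^ d \<le> cmod (p t x)})"
        using infdist_power_le_cmod_monic_poly[of "\<lambda>j. of_real (e j t)" d N] monic
        by (auto simp: T_def p_def)
    next
      fix t assume t: "t \<in> (\<Inter>x. {t \<in> {0..1}. infdist x N ^ d \<le> cmod (p t x)})"
      have "x \<in> N" if "p t x = 0" for x
      proof -
        have "infdist x N ^ d \<le> 0" using t that by (auto dest: spec[of _ x])
        then have "infdist x N = 0"
          using infdist_nonneg[of x N] \<open>d > 0\<close>
          by (metis order_antisym power_eq_0_iff zero_le_power)
        then show ?thesis
          using in_closed_iff_infdist_zero \<open>closed N\<close> \<open>N \<noteq> {}\<close> by blast
      qed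
      then show "t \<in> T" using t by (auto simp: T_def)
    qed
    show ?thesis
      unfolding T_eq p_def
      by (intro closed_INT ballI continuous_on_closed_Collect_le continuous_intros) (auto intro: cont)
  qed
  moreover have "closed U"
  proof -
    have "\<exists>B. \<forall>t\<in>{0..1}. \<bar>e j t\<bar> \<le> B" if "j \<le> d" for j
    proof -
      have "bounded (e j ` {0..1})"
        using compact_continuous_image[OF cont[OF that]] compact_imp_bounded by auto
      then show ?thesis by (auto simp: bounded_iff)
    qed
    then obtain b where b: "\<And>j t. j \<le> d \<Longrightarrow> t \<in> {0..1} \<Longrightarrow> \<bar>e j t\<bar> \<le> b j"
      by metis
    \<comment> \<open>The bounds \<open>b j\<close> are nonnegative, so their sum bounds all
      coefficients at all times.\<close>
    define B where "B = (\<Sum>j\<le>d. b j)"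
    have bB: "b j \<le> B" if "j \<le> d" for j
      unfolding B_def using that b[of _ 0]
      by (intro member_le_sum) (auto intro: order_trans[OF abs_ge_zero])
    \<comment> \<open>All pairs of a time and a root in \<open>D\<close> at that time: a compact set
      whose projection to the time axis is \<open>U\<close>.\<close>
    define K where "K = {q \<in> {0..1} \<times> cball 0 (max 1 (real d * B)). snd q \<in> D \<and> p (fst q) (snd q) = 0}"
    have "closed K"
    proof -
      let ?R = "{0..1 :: real} \<times> (cball 0 (max 1 (real d * B)) \<inter> D)"
      have K_eq: "K = {q \<in> ?R. p (fst q) (snd q) = 0}"
        by (auto simp: K_def)
      show ?thesis
        unfolding K_eq
      proof (rule continuous_closed_preimage_constant)
        show "continuous_on ?R (\<lambda>q. p (fst q) (snd q))"
          unfolding p_def by (intro continuous_intros continuous_on_compose2[OF cont]) auto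
        show "closed ?R"
          using \<open>closed D\<close> by (intro closed_Times closed_Int closed_cball closed_atLeastAtMost)
      qed
    qed
    moreover have "K \<subseteq> {0..1} \<times> cball 0 (max 1 (real d * B))"
      by (auto simp: K_def)
    then have "bounded K"
      by (rule bounded_subset[rotated]) (intro bounded_Times compact_imp_bounded[OF compact_Icc] bounded_cball)
    ultimately have "compact (fst ` K)"
      by (intro compact_continuous_image continuous_intros) (simp add: compact_eq_bounded_closed)
    moreover have "U = fst ` K"
    proof (intro equalityI subsetI)
      fix t assume "t \<in> U"
      then obtain x where x: "t \<in> {0..1}" "x \<in> D" "p t x = 0" by (auto simp: U_def)
      have "cmod x \<le> max 1 (real d * B)"
      proof (rule cmod_root_monic_poly_le[of "\<lambda>j. of_real (e j t)" d B x])
        show "cmod (complex_of_real (e j t)) \<le> B" if "j < d" for j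
          using order_trans[OF b bB, of j t] x(1) that by simp
      qed (use x monic in \<open>auto simp: p_def\<close>)
      then have "(t, x) \<in> K" using x by (auto simp: K_def)
      then show "t \<in> fst ` K" by force
    qed (auto simp: K_def U_def)
    ultimately show ?thesis using compact_imp_closed by simp
  qed
  moreover have "T \<inter> U \<inter> {0..1} = {}"
    using ND p0 by (auto simp: T_def U_def)
  moreover have "{0..1} \<subseteq> T \<union> U"
    using roots by (fastforce simp: T_def U_def p_def)
  moreover have "0 \<in> T"
    using start by (auto simp: T_def p_def)
  ultimately have "U \<inter> {0..1} = {}"
    using connected_closedD[of "{0..1 :: real}" T U] by auto
  then have "1 \<in> T"
    using subsetD[OF \<open>{0..1} \<subseteq> T \<union> U\<close>, of 1] by auto
  then show ?thesis
    using assms(10) by (auto simp: T_def p_def)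
qed

text \<open>All angles \<open>j * \<bar>\<phi>\<bar>\<close> with \<open>j \<le> n\<close> lie in
  \<open>[0, pi)\<close>, so no term of the imaginary part, up to the sign of \<open>\<phi>\<close>,
  is negative, and the leading one is positive.\<close>

lemma nonneg_poly_no_root_in_sector:
  assumes nonneg: "\<And>j. j \<le> n \<Longrightarrow> e j \<ge> (0 :: real)" and monic: "e n = 1"
    and \<rho>: "\<rho> > 0" and \<phi>: "0 < \<bar>\<phi>\<bar>" "real n * \<bar>\<phi>\<bar> < pi" and n: "n > 0"
  shows "(\<Sum>j\<le>n. of_real (e j) * rcis \<rho> \<phi> ^ j) \<noteq> 0"
proof
  assume eq: "(\<Sum>j\<le>n. of_real (e j) * rcis \<rho> \<phi> ^ j) = 0"
  have "Im (\<Sum>j\<le>n. of_real (e j) * rcis \<rho> \<phi> ^ j) = (\<Sum>j\<le>n. e j * (\<rho> ^ j * sin (real j * \<phi>)))"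
    by (simp add: DeMoivre2)
  then have "0 = sgn \<phi> * (\<Sum>j\<le>n. e j * (\<rho> ^ j * sin (real j * \<phi>)))"
    using eq by simp
  also have "\<dots> = (\<Sum>j\<le>n. e j * (\<rho> ^ j * sin (real j * \<bar>\<phi>\<bar>)))"
    unfolding sum_distrib_left by (intro sum.cong) (auto simp: sgn_if abs_if)
  also have "\<dots> > 0"
  proof (rule sum_pos2[of _ n])
    show "0 < e n * (\<rho> ^ n * sin (real n * \<bar>\<phi>\<bar>))"
      using monic \<rho> \<phi> n by (auto intro!: mult_pos_pos sin_gt_zero)
    fix j assume j: "j \<in> {..n}"
    have "real j * \<bar>\<phi>\<bar> \<le> real n * \<bar>\<phi>\<bar>"
      using j by (intro mult_right_mono) auto
    then have "real j * \<bar>\<phi>\<bar> \<le> pi"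
      using \<phi>(2) by linarith
    then show "0 \<le> e j * (\<rho> ^ j * sin (real j * \<bar>\<phi>\<bar>))"
      using nonneg[of j] \<rho> j by (intro mult_nonneg_nonneg sin_ge_zero) auto
  qed auto
  finally show False by simp
qed

text \<open>The multiples of \<open>\<bar>Arg z\<bar>\<close> advance in steps smaller than
  \<open>\<epsilon>\<close>, so they cannot jump over the interval between
  \<open>pi - \<epsilon>\<close> and \<open>pi\<close>.\<close>

lemma power_in_negative_sector:
  assumes z: "z \<noteq> 0" "Re z > cos \<epsilon> * cmod z" "\<not> (z \<in> \<real> \<and> Re z \<ge> 0)"
    and \<epsilon>: "0 < \<epsilon>" "\<epsilon> \<le> pi / 2"
  shows "\<exists>k \<phi>. k \<ge> 1 \<and> 0 < \<bar>\<phi>\<bar> \<and> \<bar>\<phi>\<bar> < \<epsilon> \<and> - (z ^ k) = rcis (cmod z ^ k) \<phi>"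
proof -
  define \<theta> where "\<theta> = Arg z"
  have zeq: "z = rcis (cmod z) \<theta>"
    by (simp add: \<theta>_def rcis_cmod_Arg)
  have "Re z = cmod z * cos \<theta>"
    by (subst zeq) simp
  then have "cos \<epsilon> < cos \<bar>\<theta>\<bar>"
    using z by (simp add: mult.commute)
  moreover have "\<bar>\<theta>\<bar> \<le> pi"
    using Arg_bounded[of z] by (auto simp: \<theta>_def)
  ultimately have le: "\<bar>\<theta>\<bar> < \<epsilon>"
    using cos_mono_less_eq[of \<epsilon> "\<bar>\<theta>\<bar>"] \<epsilon> by auto
  have "\<theta> \<noteq> 0"
  proof
    assume "\<theta> = 0"
    then have "z = of_real (cmod z)" using zeq by (simp add: rcis_def)
    then show False using z(3) by (metis Re_complex_of_real Reals_of_real norm_ge_zero)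
  qed
  then have pos: "\<bar>\<theta>\<bar> > 0" by simp
  \<comment> \<open>The least \<open>k\<close> with
    \<open>k * \<bar>\<theta>\<bar> > pi - \<epsilon>\<close>; as the step is below
    \<open>\<epsilon>\<close>, this multiple is still below \<open>pi\<close>.\<close>
  define k where "k = nat \<lfloor>(pi - \<epsilon>) / \<bar>\<theta>\<bar>\<rfloor> + 1"
  have q: "(pi - \<epsilon>) / \<bar>\<theta>\<bar> \<ge> 0" using \<epsilon> pos by simp
  then have "real k = real_of_int \<lfloor>(pi - \<epsilon>) / \<bar>\<theta>\<bar>\<rfloor> + 1" by (simp add: k_def)
  then have "real k > (pi - \<epsilon>) / \<bar>\<theta>\<bar>" "real k \<le> (pi - \<epsilon>) / \<bar>\<theta>\<bar> + 1"
    by linarith+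
  then have k: "real k * \<bar>\<theta>\<bar> > pi - \<epsilon>" "real k * \<bar>\<theta>\<bar> \<le> pi - \<epsilon> + \<bar>\<theta>\<bar>"
    using pos by (auto simp: field_simps)
  \<comment> \<open>Negation turns the angle by \<open>pi\<close>; the direction of the turn is
    chosen so that the result is small.\<close>
  define \<phi> where "\<phi> = real k * \<theta> - sgn \<theta> * pi"
  have "\<bar>\<phi>\<bar> = pi - real k * \<bar>\<theta>\<bar>"
    using k le \<open>\<theta> \<noteq> 0\<close> unfolding \<phi>_def by (auto simp: sgn_if abs_if split: if_splits)
  then have "0 < \<bar>\<phi>\<bar>" "\<bar>\<phi>\<bar> < \<epsilon>"
    using k le by linarith+
  moreover have "- (z ^ k) = rcis (cmod z ^ k) \<phi>"
  proof -
    have "z ^ k = rcis (cmod z ^ k) (real k * \<theta>)"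
      by (subst zeq) (simp add: DeMoivre2)
    moreover have "cis \<phi> = - cis (real k * \<theta>)"
      using \<open>\<theta> \<noteq> 0\<close> by (auto simp: \<phi>_def sgn_if complex_eq_iff)
    ultimately show ?thesis by (simp add: rcis_def)
  qed
  ultimately show ?thesis
    by (intro exI[of _ k] exI[of _ \<phi>]) (auto simp: k_def)
qed

subsection \<open>Alternating products\<close>

lemma alternating_prod_carrier:
  assumes "\<And>i. i \<in> {1..2 * r} \<Longrightarrow> F i \<in> carrier_mat n m"
  shows "alternating_prod n F r \<in> carrier_mat n n"
  using assms
proof (induction r)
  case (Suc r)
  have "F (2 * r + 1) \<in> carrier_mat n m" "F (2 * r + 2) \<in> carrier_mat n m"
    using Suc.prems by auto
  moreover have "alternating_prod n F r \<in> carrier_mat n n"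
    using Suc by auto
  ultimately show ?case by auto
qed simp

lemma alternating_prod_cong:
  assumes "\<And>i. i \<in> {1..2 * r} \<Longrightarrow> F i = G i"
  shows "alternating_prod n F r = alternating_prod n G r"
  using assms by (induction r) auto

lemma alternating_prod_add:
  assumes "\<And>i. i \<in> {1..2 * (r + s)} \<Longrightarrow> F i \<in> carrier_mat n m"
  shows "alternating_prod n F (r + s) = alternating_prod n F r * alternating_prod n (\<lambda>i. F (i + 2 * r)) s"
  using assms
proof (induction s)
  case 0
  have "alternating_prod n F r \<in> carrier_mat n n"
    using 0 by (intro alternating_prod_carrier[of _ _ _ m]) auto
  then show ?case by simp
next
  case (Suc s)
  have P: "alternating_prod n F r \<in> carrier_mat n n"
    using Suc.prems by (intro alternating_prod_carrier[of _ _ _ m]) auto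
  have Q: "alternating_prod n (\<lambda>i. F (i + 2 * r)) s \<in> carrier_mat n n"
    using Suc.prems by (intro alternating_prod_carrier[of _ _ _ m]) auto
  have R: "F (2 * (r + s) + 1) \<in> carrier_mat n m" "F (2 * (r + s) + 2) \<in> carrier_mat n m"
    using Suc.prems by auto
  have idx: "2 * (r + s) + 1 = 2 * s + 1 + 2 * r" "2 * (r + s) + 2 = 2 * s + 2 + 2 * r" by auto
  have "alternating_prod n F (r + Suc s) = alternating_prod n F r * alternating_prod n (\<lambda>i. F (i + 2 * r)) s *
      (F (2 * (r + s) + 1) * transpose_mat (F (2 * (r + s) + 2)))"
    using Suc by simp
  also have "\<dots> = alternating_prod n F r * (alternating_prod n (\<lambda>i. F (i + 2 * r)) s *
      (F (2 * (r + s) + 1) * transpose_mat (F (2 * (r + s) + 2))))"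
    using P Q R by (intro assoc_mult_mat[of _ n n _ n _ n]) auto
  finally show ?case
    unfolding idx by simp
qed

section \<open>Products and powers within the sign class powers\<close>

lemma sign_class_power_carrier:
  assumes "A \<in> carrier_mat n m" "M \<in> sign_class_power A r"
  shows "M \<in> carrier_mat n n"
proof -
  obtain F where "M = alternating_prod n F r" "\<forall>i\<in>{1..2 * r}. F i \<in> sign_class A"
    using assms by (auto simp: sign_class_power_def)
  then show ?thesis
    using assms alternating_prod_carrier[of r F n m] by (auto simp: sign_class_def)
qed

lemma sign_class_power_mult:
  assumes A: "A \<in> carrier_mat n m"
    and M: "M \<in> sign_class_power A r" and N: "N \<in> sign_class_power A s"
  shows "M * N \<in> sign_class_power A (r + s)"
proof -
  obtain F where F: "M = alternating_prod n F r" "\<And>i. i \<in> {1..2 * r} \<Longrightarrow> F i \<in> sign_class A"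
    using A M by (auto simp: sign_class_power_def)
  obtain G where G: "N = alternating_prod n G s" "\<And>i. i \<in> {1..2 * s} \<Longrightarrow> G i \<in> sign_class A"
    using A N by (auto simp: sign_class_power_def)
  \<comment> \<open>The concatenation of the two families; indices start at 1, so \<open>G\<close>
    begins after position \<open>2 * r\<close>.\<close>
  define H where "H i = (if i \<le> 2 * r then F i else G (i - 2 * r))" for i
  have H: "H i \<in> sign_class A" if "i \<in> {1..2 * (r + s)}" for i
  proof (cases "i \<le> 2 * r")
    case False
    then have "i - 2 * r \<in> {1..2 * s}" using that by auto
    then show ?thesis using False G(2) by (simp add: H_def)
  qed (use that F(2) in \<open>auto simp: H_def\<close>)
  have "alternating_prod n H (r + s) = alternating_prod n H r * alternating_prod n (\<lambda>i. H (i + 2 * r)) s"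
    using H A by (intro alternating_prod_add[of _ _ _ _ m]) (auto simp: sign_class_def)
  also have "alternating_prod n H r = M"
    unfolding F(1) by (rule alternating_prod_cong) (simp add: H_def)
  also have "alternating_prod n (\<lambda>i. H (i + 2 * r)) s = N"
    unfolding G(1) by (rule alternating_prod_cong) (simp add: H_def)
  finally show ?thesis
    using H A by (auto simp: sign_class_power_def intro!: exI[of _ H])
qed

text \<open>This brings every positive power of \<open>M\<close> under the hypothesis on
  \<open>P0_matrices\<close>, which speaks of all \<open>r\<close>.\<close>

lemma sign_class_power_pow:
  assumes A: "A \<in> carrier_mat n m" and M: "M \<in> sign_class_power A r"
  shows "M ^\<^sub>m Suc k \<in> sign_class_power A (Suc k * r)"
proof (induction k)
  case 0
  then show ?case using M sign_class_power_carrier[OF A M] by simp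
next
  case (Suc k)
  then show ?case
    using sign_class_power_mult[OF A Suc M] by (simp add: add.commute)
qed

section \<open>Dependence of a product on a single entry of a single factor\<close>

definition rank_one_line :: "nat \<Rightarrow> (real \<Rightarrow> real mat) \<Rightarrow> bool" where
  "rank_one_line n M \<longleftrightarrow> (\<exists>B x y. B \<in> carrier_mat n n \<and>
     (\<forall>s. M s = mat n n (\<lambda>(i, j). B $$ (i, j) + s * (x i * y j))))"

lemma rank_one_lineI:
  assumes "B \<in> carrier_mat n n" "\<And>s. M s = mat n n (\<lambda>(i, j). B $$ (i, j) + s * (x i * y j))"
  shows "rank_one_line n M"
  using assms unfolding rank_one_line_def by blast

lemma rank_one_line_const: "B \<in> carrier_mat n n \<Longrightarrow> rank_one_line n (\<lambda>s. B)"
  unfolding rank_one_line_def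
  by (intro exI[of _ B] exI[of _ "\<lambda>i. 0"]) auto

lemma rank_one_line_mult_right:
  assumes "rank_one_line n M" "Q \<in> carrier_mat n n"
  shows "rank_one_line n (\<lambda>s. M s * Q)"
proof -
  obtain B x y where B: "B \<in> carrier_mat n n"
    and M: "\<And>s. M s = mat n n (\<lambda>(i, j). B $$ (i, j) + s * (x i * y j))"
    using assms(1) by (auto simp: rank_one_line_def)
  have "M s * Q = mat n n (\<lambda>(i, j). (B * Q) $$ (i, j) + s * (x i * (\<Sum>k = 0..<n. y k * Q $$ (k, j))))" for s
    using B assms(2) unfolding M
    by (intro eq_matI) (auto simp: scalar_prod_def sum_distrib_left sum.distrib[symmetric] algebra_simps)
  then show ?thesis
    using B assms(2) by (intro rank_one_lineI[of "B * Q"]) auto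
qed

lemma rank_one_line_mult_left:
  assumes "rank_one_line n M" "P \<in> carrier_mat n n"
  shows "rank_one_line n (\<lambda>s. P * M s)"
proof -
  obtain B x y where B: "B \<in> carrier_mat n n"
    and M: "\<And>s. M s = mat n n (\<lambda>(i, j). B $$ (i, j) + s * (x i * y j))"
    using assms(1) by (auto simp: rank_one_line_def)
  have "P * M s = mat n n (\<lambda>(i, j). (P * B) $$ (i, j) + s * ((\<Sum>k = 0..<n. P $$ (i, k) * x k) * y j))" for s
    using B assms(2) unfolding M
    by (intro eq_matI)
       (auto simp: scalar_prod_def sum_distrib_left sum_distrib_right sum.distrib[symmetric] algebra_simps)
  then show ?thesis
    using B assms(2) by (intro rank_one_lineI[of "P * B"]) auto
qed

text \<open>All entries of all factors become coordinates of one function on triples (factor, row,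
  column), so that varying one entry is a function update.\<close>

definition factors :: "nat \<Rightarrow> nat \<Rightarrow> (nat \<times> nat \<times> nat \<Rightarrow> real) \<Rightarrow> nat \<Rightarrow> real mat" where
  "factors n m \<Phi> l = mat n m (\<lambda>(i, j). \<Phi> (l, i, j))"

lemma factors_carrier [simp]: "factors n m \<Phi> l \<in> carrier_mat n m"
  by (simp add: factors_def)

text \<open>Varying the entry \<open>(a, b)\<close> of the first factor adds a multiple of the outer
  product of the unit vector \<open>a\<close> and column \<open>b\<close> of the second factor; the
  other case is symmetric. As \<open>l \<noteq> l'\<close>, the entry never occurs in both.\<close>

lemma rank_one_line_factor_pair:
  assumes "l \<noteq> l'"
  shows "rank_one_line n (\<lambda>s. factors n m (\<Phi>(c := s)) l * transpose_mat (factors n m (\<Phi>(c := s)) l'))"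
proof -
  obtain c1 a b where c: "c = (c1, a, b)" by (cases c) auto
  define F where "F s = factors n m (\<Phi>(c := s)) l" for s
  define G where "G s = factors n m (\<Phi>(c := s)) l'" for s
  have FG: "F s * transpose_mat (G s) = mat n n (\<lambda>(i, j). \<Sum>q = 0..<m. F s $$ (i, q) * G s $$ (j, q))" for s
    by (intro eq_matI) (auto simp: F_def G_def factors_def scalar_prod_def)
  have FG0: "F 0 * transpose_mat (G 0) \<in> carrier_mat n n"
    unfolding FG by simp
  consider "c1 = l" | "c1 = l'" | "c1 \<noteq> l" "c1 \<noteq> l'" by blast
  then have "rank_one_line n (\<lambda>s. F s * transpose_mat (G s))"
  proof cases
    case 1
    \<comment> \<open>\<open>G\<close> does not depend on \<open>s\<close> here. The coordinate
      \<open>c\<close> is arbitrary, hence the guard \<open>b < m\<close>.\<close>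
    have "F s * transpose_mat (G s) = mat n n (\<lambda>(i, j). (F 0 * transpose_mat (G 0)) $$ (i, j) +
        s * ((if i = a then 1 else 0) * (if b < m then G 0 $$ (j, b) else 0)))" for s
    proof -
      have "(\<Sum>q = 0..<m. F s $$ (i, q) * G s $$ (j, q)) = (\<Sum>q = 0..<m. F 0 $$ (i, q) * G 0 $$ (j, q)) +
          s * ((if i = a then 1 else 0) * (if b < m then G 0 $$ (j, b) else 0))"
        if ij: "i < n" "j < n" for i j
      proof -
        have "(\<Sum>q = 0..<m. F s $$ (i, q) * G s $$ (j, q)) = (\<Sum>q = 0..<m. F 0 $$ (i, q) * G 0 $$ (j, q) +
            (if q = b then (if i = a then s * G 0 $$ (j, b) else 0) else 0))"
          using 1 assms ij by (intro sum.cong) (auto simp: F_def G_def factors_def c)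
        then show ?thesis by (simp add: sum.distrib)
      qed
      then show ?thesis
        unfolding FG by (intro eq_matI) auto
    qed
    then show ?thesis
      by (rule rank_one_lineI[OF FG0])
  next
    case 2
    have "F s * transpose_mat (G s) = mat n n (\<lambda>(i, j). (F 0 * transpose_mat (G 0)) $$ (i, j) +
        s * ((if b < m then F 0 $$ (i, b) else 0) * (if j = a then 1 else 0)))" for s
    proof -
      have "(\<Sum>q = 0..<m. F s $$ (i, q) * G s $$ (j, q)) = (\<Sum>q = 0..<m. F 0 $$ (i, q) * G 0 $$ (j, q)) +
          s * ((if b < m then F 0 $$ (i, b) else 0) * (if j = a then 1 else 0))"
        if ij: "i < n" "j < n" for i j
      proof -
        have "(\<Sum>q = 0..<m. F s $$ (i, q) * G s $$ (j, q)) = (\<Sum>q = 0..<m. F 0 $$ (i, q) * G 0 $$ (j, q) +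
            (if q = b then (if j = a then s * F 0 $$ (i, b) else 0) else 0))"
          using 2 assms ij by (intro sum.cong) (auto simp: F_def G_def factors_def c)
        then show ?thesis by (simp add: sum.distrib)
      qed
      then show ?thesis
        unfolding FG by (intro eq_matI) auto
    qed
    then show ?thesis
      by (rule rank_one_lineI[OF FG0])
  next
    case 3
    have "F s = F 0" "G s = G 0" for s
      using 3 by (auto simp: F_def G_def factors_def c)
    then have "(\<lambda>s. F s * transpose_mat (G s)) = (\<lambda>s. F 0 * transpose_mat (G 0))"
      by (intro ext) metis
    then show ?thesis
      using rank_one_line_const[OF FG0] by simp
  qed
  then show ?thesis by (simp add: F_def G_def)
qed

text \<open>The varied entry sits in at most one factor. Hence either the last pair or the product
  before it is constant, and multiplying a line by a constant matrix yields a line.\<close>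

lemma rank_one_line_alternating_prod:
  "rank_one_line n (\<lambda>s. alternating_prod n (factors n m (\<Phi>(c := s))) r)"
proof (induction r)
  case 0
  then show ?case by (auto intro: rank_one_line_const)
next
  case (Suc r)
  define P where "P = (\<lambda>s. alternating_prod n (factors n m (\<Phi>(c := s))) r)"
  define Q where "Q = (\<lambda>s. factors n m (\<Phi>(c := s)) (2 * r + 1) *
    transpose_mat (factors n m (\<Phi>(c := s)) (2 * r + 2)))"
  have P: "P s \<in> carrier_mat n n" for s
    unfolding P_def by (intro alternating_prod_carrier[of _ _ _ m]) auto
  have Q: "Q s \<in> carrier_mat n n" for s
    unfolding Q_def by (intro mult_carrier_mat[of _ n m]) auto
  have P1: "rank_one_line n (\<lambda>s. P s)"
    unfolding P_def by (rule Suc)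
  have Q1: "rank_one_line n (\<lambda>s. Q s)"
    unfolding Q_def by (rule rank_one_line_factor_pair) simp
  have "rank_one_line n (\<lambda>s. P s * Q s)"
  proof (cases "fst c \<in> {1..2 * r}")
    case True
    then have fac: "factors n m (\<Phi>(c := s)) l = factors n m (\<Phi>(c := 0)) l" if "l > 2 * r" for l s
      using that by (cases c) (auto simp: factors_def)
    have Q0: "Q s = Q 0" for s
      using fac[of "2 * r + 1" s] fac[of "2 * r + 2" s] unfolding Q_def by simp
    have "(\<lambda>s. P s * Q s) = (\<lambda>s. P s * Q 0)"
      by (intro ext arg_cong[where f = "(*) _"] Q0)
    then show ?thesis
      using rank_one_line_mult_right[OF P1 Q] by simp
  next
    case False
    then have "factors n m (\<Phi>(c := s)) l = factors n m (\<Phi>(c := 0)) l" if "l \<in> {1..2 * r}" for l s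
      using that by (cases c) (auto simp: factors_def)
    then have P0: "P s = P 0" for s
      unfolding P_def by (rule alternating_prod_cong)
    have "(\<lambda>s. P s * Q s) = (\<lambda>s. P 0 * Q s)"
      by (intro ext arg_cong[where f = "\<lambda>X. X * _"] P0)
    then show ?thesis
      using rank_one_line_mult_left[OF Q1 P] by simp
  qed
  then show ?case unfolding P_def Q_def alternating_prod.simps .
qed

lemma minor_sum_alternating_prod_affine:
  "\<exists>a b. \<forall>s. minor_sum n k (alternating_prod n (factors n m (\<Phi>(c := s))) r) = a + b * s"
proof -
  obtain B x y where "B \<in> carrier_mat n n"
    "\<And>s. alternating_prod n (factors n m (\<Phi>(c := s))) r = mat n n (\<lambda>(i, j). B $$ (i, j) + s * (x i * y j))"
    using rank_one_line_alternating_prod[of n m \<Phi> c r] by (auto simp: rank_one_line_def)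
  then show ?thesis
    using minor_sum_rank_one_update[of B n k x y] by simp
qed

text \<open>An affine function that is nonnegative on an open half-line and vanishes at a point of
  it is constant. Changing the coordinates one at a time carries the zero from \<open>\<Phi>\<close>
  to \<open>\<Psi>\<close>.\<close>

lemma multiaffine_nonneg_zero:
  fixes f :: "('c \<Rightarrow> real) \<Rightarrow> real"
  assumes affine: "\<And>\<Phi> c. \<exists>a b. \<forall>s. f (\<Phi>(c := s)) = a + b * s"
    and nonneg: "\<And>\<Phi>. (\<And>c. sgn (\<Phi> c) = \<sigma> c) \<Longrightarrow> f \<Phi> \<ge> 0"
    and \<Phi>: "\<And>c. sgn (\<Phi> c) = \<sigma> c" and \<Psi>: "\<And>c. sgn (\<Psi> c) = \<sigma> c"
    and zero: "f \<Phi> = 0" and fin: "finite {c. \<Phi> c \<noteq> \<Psi> c}"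
  shows "f \<Psi> = 0"
proof -
  have step: "f (\<Theta>(c := v)) = 0"
    if \<Theta>: "\<And>c. sgn (\<Theta> c) = \<sigma> c" "f \<Theta> = 0" and v: "sgn v = \<sigma> c" for \<Theta> c v
  proof -
    obtain a b where ab: "\<And>s. f (\<Theta>(c := s)) = a + b * s"
      using affine by metis
    have ge: "a + b * s \<ge> 0" if "sgn s = \<sigma> c" for s
      unfolding ab[symmetric] by (rule nonneg) (use \<Theta>(1) that in auto)
    have eq: "a + b * \<Theta> c = 0"
      using ab[of "\<Theta> c"] \<Theta>(2) by simp
    have "b = 0 \<or> \<Theta> c = 0"
    proof -
      \<comment> \<open>Both values have the sign of \<open>\<Theta> c\<close> and, if it is
        nonzero, lie on either side of it, which rules out a nonzero slope.\<close>
      have "a + b * (\<Theta> c / 2) \<ge> 0" "a + b * (\<Theta> c * 2) \<ge> 0"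
        by (intro ge; simp add: sgn_mult \<Theta>(1))+
      then have "b * \<Theta> c = 0" using eq by linarith
      then show ?thesis by simp
    qed
    moreover have "v = 0" if "\<Theta> c = 0"
      using that v \<Theta>(1)[of c] by (metis sgn_0_0)
    ultimately show ?thesis using ab eq by auto
  qed
  \<comment> \<open>Intermediate points that have already moved to \<open>\<Psi>\<close> in the
    coordinates from \<open>C\<close>.\<close>
  define \<Theta> where "\<Theta> C = (\<lambda>c. if c \<in> C then \<Psi> c else \<Phi> c)" for C
  have "f (\<Theta> {c. \<Phi> c \<noteq> \<Psi> c}) = 0"
    using fin
  proof (induction rule: finite_induct)
    case empty
    then show ?case using zero by (simp add: \<Theta>_def)
  next
    case (insert c C)
    have "\<Theta> (insert c C) = (\<Theta> C)(c := \<Psi> c)"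
      by (auto simp: \<Theta>_def)
    moreover have "f ((\<Theta> C)(c := \<Psi> c)) = 0"
      using insert by (intro step) (auto simp: \<Theta>_def \<Phi> \<Psi>)
    ultimately show ?case by (simp only:)
  qed
  moreover have "\<Theta> {c. \<Phi> c \<noteq> \<Psi> c} = \<Psi>"
    by (auto simp: \<Theta>_def)
  ultimately show ?thesis by simp
qed

lemma continuous_on_alternating_prod:
  assumes "\<And>c. continuous_on T (\<lambda>t. \<Phi> t c)" "i < n" "j < n"
  shows "continuous_on T (\<lambda>t. alternating_prod n (factors n m (\<Phi> t)) r $$ (i, j))"
  using assms(2,3)
proof (induction r arbitrary: i j)
  case (Suc r)
  have P: "alternating_prod n (factors n m (\<Phi> t)) r \<in> carrier_mat n n" for t
    by (intro alternating_prod_carrier[of _ _ _ m]) auto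
  then have "alternating_prod n (factors n m (\<Phi> t)) (Suc r) $$ (i, j) =
     (\<Sum>k = 0..<n. alternating_prod n (factors n m (\<Phi> t)) r $$ (i, k) *
       (\<Sum>q = 0..<m. \<Phi> t (2 * r + 1, k, q) * \<Phi> t (2 * r + 2, j, q)))" for t
    using Suc.prems carrier_matD[OF P]
    by (auto simp: factors_def scalar_prod_def simp del: mult_carrier_mat intro!: sum.cong)
  then show ?case
    using Suc by (auto intro!: continuous_intros assms(1))
qed auto

subsection \<open>Eigenvalues\<close>

text \<open>Since the coefficients belong to \<open>det (M + x I)\<close>, the roots are the negated
  eigenvalues. Sectors and half-axes are mirrored accordingly below.\<close>

lemma eigenvalue_iff_minor_sum:
  assumes "M \<in> carrier_mat n n"
  shows "eigenvalue (map_mat complex_of_real M) z \<longleftrightarrow>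
    (\<Sum>k\<le>n. of_real (minor_sum n k M) * (- z) ^ k) = 0"
proof -
  have M: "map_mat complex_of_real M \<in> carrier_mat n n" using assms by simp
  show ?thesis
    unfolding eigenvalue_det[OF M] char_matrix_def
    using assms det_add_scalar[OF M, of "- z"] by (simp add: minor_sum_of_real)
qed

text \<open>Pairing the eigenvector equation with \<open>v\<close> gives \<open>z\<close> times the
  squared norm of \<open>v\<close> on one side and the squared norm of \<open>w\<close>, the
  transpose of \<open>K\<close> applied to \<open>v\<close>, on the other.\<close>

lemma eigenvalue_gram_mat:
  fixes K :: "real mat"
  assumes K: "K \<in> carrier_mat n k"
    and ev: "eigenvalue (map_mat complex_of_real (K * transpose_mat K)) z"
  shows "z \<in> \<real> \<and> Re z \<ge> 0"
proof -
  obtain v where v: "v \<in> carrier_vec n" "v \<noteq> 0\<^sub>v n"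
    "map_mat complex_of_real (K * transpose_mat K) *\<^sub>v v = z \<cdot>\<^sub>v v"
    using ev K by (auto simp: eigenvalue_def eigenvector_def)
  define w where "w q = (\<Sum>j = 0..<n. of_real (K $$ (j, q)) * v $ j)" for q
  have cnj_w: "cnj (w q) = (\<Sum>j = 0..<n. of_real (K $$ (j, q)) * cnj (v $ j))" for q
    by (simp add: w_def)
  have row: "(\<Sum>q = 0..<k. of_real (K $$ (i, q)) * w q) = z * v $ i" if i: "i < n" for i
  proof -
    have "z * v $ i = (map_mat complex_of_real (K * transpose_mat K) *\<^sub>v v) $ i"
      using v i by simp
    also have "\<dots> = (\<Sum>j = 0..<n. (\<Sum>q = 0..<k. of_real (K $$ (i, q)) * of_real (K $$ (j, q))) * v $ j)"
      using K v(1) i by (auto simp: scalar_prod_def intro!: sum.cong)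
    also have "\<dots> = (\<Sum>q = 0..<k. of_real (K $$ (i, q)) * w q)"
      unfolding w_def sum_distrib_left sum_distrib_right by (subst sum.swap) (simp add: ac_simps)
    finally show ?thesis by simp
  qed
  have "z * of_real (\<Sum>i = 0..<n. (cmod (v $ i))\<^sup>2) = (\<Sum>i = 0..<n. cnj (v $ i) * (z * v $ i))"
    by (simp add: sum_distrib_left complex_norm_square ac_simps del: of_real_power)
  also have "\<dots> = (\<Sum>i = 0..<n. cnj (v $ i) * (\<Sum>q = 0..<k. of_real (K $$ (i, q)) * w q))"
    using row by simp
  also have "\<dots> = (\<Sum>q = 0..<k. cnj (w q) * w q)"
    unfolding cnj_w sum_distrib_left sum_distrib_right by (subst sum.swap) (simp add: ac_simps)
  also have "\<dots> = of_real (\<Sum>q = 0..<k. (cmod (w q))\<^sup>2)"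
    by (simp add: complex_norm_square ac_simps del: of_real_power)
  finally have eq: "z * of_real (\<Sum>i = 0..<n. (cmod (v $ i))\<^sup>2) = of_real (\<Sum>q = 0..<k. (cmod (w q))\<^sup>2)" .
  obtain i where i: "i < n" "v $ i \<noteq> 0"
    using v(1,2) by (metis carrier_vecD dim_vec eq_vecI index_zero_vec)
  have "(\<Sum>i = 0..<n. (cmod (v $ i))\<^sup>2) > 0"
    using i by (intro sum_pos2[of _ i]) auto
  then have "z = of_real ((\<Sum>q = 0..<k. (cmod (w q))\<^sup>2) / (\<Sum>i = 0..<n. (cmod (v $ i))\<^sup>2))"
    using eq by (simp add: field_simps del: of_real_sum)
  moreover have "(\<Sum>q = 0..<k. (cmod (w q))\<^sup>2) / (\<Sum>i = 0..<n. (cmod (v $ i))\<^sup>2) \<ge> 0"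
    by (intro divide_nonneg_nonneg sum_nonneg) auto
  ultimately show ?thesis by simp
qed

text \<open>Every power of the symmetric \<open>?B\<close> is a Gram matrix: start from the identity
  or from \<open>A\<close>, and pass from \<open>r\<close> to \<open>r + 2\<close> by multiplying
  with \<open>?B\<close> on both sides.\<close>

lemma alternating_prod_const_gram:
  fixes A :: "real mat"
  assumes A: "A \<in> carrier_mat n m"
  shows "\<exists>k. \<exists>K \<in> carrier_mat n k. alternating_prod n (\<lambda>_. A) r = K * transpose_mat K"
proof (induction r rule: induct_nat_012)
  case 0
  show ?case by (intro exI[of _ n] bexI[of _ "1\<^sub>m n"]) auto
next
  case 1
  show ?case using A by (intro exI[of _ m] bexI[of _ A]) auto
next
  case (ge2 r)
  let ?B = "A * transpose_mat A"
  obtain k K where K: "K \<in> carrier_mat n k" "alternating_prod n (\<lambda>_. A) r = K * transpose_mat K"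
    using ge2 by blast
  have B: "?B \<in> carrier_mat n n" using A by auto
  have sym: "transpose_mat ?B = ?B" using A by (simp add: transpose_mult[of _ n m])
  have "alternating_prod n (\<lambda>_. A) (1 + Suc r) = alternating_prod n (\<lambda>_. A) 1 * alternating_prod n (\<lambda>_. A) (Suc r)"
    using A by (intro alternating_prod_add[of _ _ _ _ m]) auto
  then have "alternating_prod n (\<lambda>_. A) (Suc (Suc r)) = ?B * (K * transpose_mat K * ?B)"
    using K B by (simp add: left_mult_one_mat[OF B])
  also have "\<dots> = (?B * K) * transpose_mat (?B * K)"
    using K(1) B by (simp add: transpose_mult[OF B K(1)] sym assoc_mult_mat[of _ n n _ k _ n]
        assoc_mult_mat[of _ n k _ n _ n])
  finally show ?case
    using K(1) B by (intro exI[of _ k] bexI[of _ "?B * K"]) auto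
qed

text \<open>An eigenvalue violating this would have a power \<open>z ^ k\<close> near the negative
  axis. But \<open>z ^ k\<close> is an eigenvalue of \<open>M ^\<^sub>m k\<close>, which is again in
  \<open>P0_matrices\<close>, so \<open>- (z ^ k)\<close> is a root of a polynomial with nonnegative
  coefficients too close to the positive axis.\<close>

lemma eigenvalue_sector:
  assumes A: "A \<in> carrier_mat n m" and n: "n > 0"
    and P0: "\<And>r. r \<ge> 1 \<Longrightarrow> sign_class_power A r \<subseteq> P0_matrices"
    and M: "M \<in> sign_class_power A r" and r: "r \<ge> 1"
    and ev: "eigenvalue (map_mat complex_of_real M) z"
  shows "(z \<in> \<real> \<and> Re z \<ge> 0) \<or> Re z \<le> cos (pi / (real n + 1)) * cmod z"
proof (rule ccontr)
  assume neg: "\<not> ?thesis"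
  \<comment> \<open>The denominator \<open>n + 1\<close> gives \<open>n * \<epsilon> < pi\<close>
    and, for every \<open>n \<ge> 1\<close>, also \<open>\<epsilon> \<le> pi / 2\<close>.\<close>
  define \<epsilon> where "\<epsilon> = pi / (real n + 1)"
  have \<epsilon>: "0 < \<epsilon>" "\<epsilon> \<le> pi / 2"
    using n by (auto simp: \<epsilon>_def field_simps)
  have "z \<noteq> 0" using neg by auto
  then obtain k \<phi> where k: "k \<ge> 1" "0 < \<bar>\<phi>\<bar>" "\<bar>\<phi>\<bar> < \<epsilon>" "- (z ^ k) = rcis (cmod z ^ k) \<phi>"
    using power_in_negative_sector[of z \<epsilon>] neg \<epsilon> by (auto simp: \<epsilon>_def)
  have Mc: "M \<in> carrier_mat n n"
    by (rule sign_class_power_carrier[OF A M])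
  have Mk: "M ^\<^sub>m k \<in> carrier_mat n n" using Mc by (rule pow_carrier_mat)
  obtain k' where k': "k = Suc k'" using k(1) by (cases k) auto
  have "M ^\<^sub>m k \<in> P0_matrices"
    using sign_class_power_pow[OF A M, of k'] P0[of "Suc k' * r"] r by (auto simp: k')
  then have nonneg: "minor_sum n j (M ^\<^sub>m k) \<ge> 0" for j
    using minor_sum_nonneg Mk by blast
  obtain v where v: "eigenvector (map_mat complex_of_real M) v z"
    using ev by (auto simp: eigenvalue_def)
  have "map_mat complex_of_real (M ^\<^sub>m k) = map_mat complex_of_real M ^\<^sub>m k"
    by (rule of_real_hom.mat_hom_pow[OF Mc])
  then have "eigenvector (map_mat complex_of_real (M ^\<^sub>m k)) v (z ^ k)"
    using eigenvector_pow[of "map_mat complex_of_real M" n v z k] v Mc Mk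
    by (simp add: eigenvector_def)
  then have "(\<Sum>j\<le>n. of_real (minor_sum n j (M ^\<^sub>m k)) * (rcis (cmod z ^ k) \<phi>) ^ j) = 0"
    unfolding k(4)[symmetric] eigenvalue_iff_minor_sum[OF Mk, symmetric] eigenvalue_def by blast
  moreover have "real n * \<bar>\<phi>\<bar> < pi"
  proof -
    have "real n * \<bar>\<phi>\<bar> < real n * \<epsilon>" using k(3) n by simp
    also have "\<dots> < pi" by (simp add: \<epsilon>_def field_simps)
    finally show ?thesis .
  qed
  ultimately show False
    using nonneg_poly_no_root_in_sector[of n "\<lambda>j. minor_sum n j (M ^\<^sub>m k)" "cmod z ^ k" \<phi>]
      nonneg minor_sum_top[of n "M ^\<^sub>m k"] k(2) n \<open>z \<noteq> 0\<close> by simp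
qed

lemma sign_class_power_eigenvalue_nonneg:
  assumes A: "A \<in> carrier_mat n m"
    and P0: "\<And>r. r \<ge> 1 \<Longrightarrow> sign_class_power A r \<subseteq> P0_matrices"
    and r: "r \<ge> 1" and M: "M \<in> sign_class_power A r"
    and ev: "eigenvalue (map_mat complex_of_real M) z"
  shows "z \<in> \<real> \<and> Re z \<ge> 0"
\<comment> \<open>The eigenvalue \<open>0\<close> is settled separately because the path argument
  works with the polynomial divided by its power of \<open>x\<close>.\<close>
proof (cases "z = 0")
  case False
  have Mc: "M \<in> carrier_mat n n"
    by (rule sign_class_power_carrier[OF A M])
  have n: "n > 0"
  proof (rule ccontr)
    assume "\<not> n > 0"
    then show False using ev Mc by (auto simp: eigenvalue_def eigenvector_def)
  qed
  obtain F where F: "M = alternating_prod n F r" "\<And>i. i \<in> {1..2 * r} \<Longrightarrow> F i \<in> sign_class A"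
    using A M by (auto simp: sign_class_power_def)
  \<comment> \<open>Coordinates outside this finite box are frozen at \<open>0\<close>, so two
    points of the path differ in finitely many coordinates only.\<close>
  define in_range where "in_range c \<longleftrightarrow> c \<in> {1..2 * r} \<times> {..<n} \<times> {..<m}" for c :: "nat \<times> nat \<times> nat"
  define \<Phi> where "\<Phi> t = (\<lambda>c. if in_range c then
      (1 - t) * A $$ snd c + t * F (fst c) $$ snd c else 0)" for t
  define \<sigma> where "\<sigma> c = (if in_range c then sgn (A $$ snd c) else 0)" for c
  define N where "N t = alternating_prod n (factors n m (\<Phi> t)) r" for t
  define e where "e k t = minor_sum n k (N t)" for k t
  have Nc: "N t \<in> carrier_mat n n" for t
    unfolding N_def by (rule alternating_prod_carrier[of _ _ _ m]) simp
  have in_class: "alternating_prod n (factors n m \<Psi>) r \<in> sign_class_power A r"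
    if "\<And>c. sgn (\<Psi> c) = \<sigma> c" for \<Psi>
    using that A unfolding sign_class_power_def
    by (auto intro!: exI[of _ "factors n m \<Psi>"] simp: sign_class_def \<sigma>_def in_range_def factors_def)
  have sgn_\<Phi>: "sgn (\<Phi> t c) = \<sigma> c" if t: "t \<in> {0..1}" for t c
  proof (cases "in_range c")
    case True
    obtain i a b where c: "c = (i, a, b)" by (cases c)
    define u v where "u = A $$ (a, b)" and "v = F i $$ (a, b)"
    have "sgn v = sgn u"
      using True F(2)[of i] A by (auto simp: u_def v_def c in_range_def sign_class_def)
    moreover have "sgn ((1 - t) * u + t * v) = sgn u" if uv: "sgn v = sgn u"
    proof -
      consider "u > 0" "v > 0" | "u < 0" "v < 0" | "u = 0" "v = 0"
        using uv by (cases u "0 :: real" rule: linorder_cases) (auto simp: sgn_if split: if_splits)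
      then show ?thesis
      proof cases
        case 1
        then have "(1 - t) * u + t * v > 0"
          using t by (cases "t = 0") (auto intro: add_nonneg_pos)
        then show ?thesis using 1 by simp
      next
        case 2
        then have "(1 - t) * u + t * v < 0"
          using t by (cases "t = 0") (auto intro!: add_nonpos_neg mult_nonneg_nonpos mult_pos_neg)
        then show ?thesis using 2 by simp
      qed auto
    qed
    ultimately show ?thesis
      using True by (simp add: \<Phi>_def \<sigma>_def c u_def v_def)
  qed (simp add: \<Phi>_def \<sigma>_def)
  have N_class: "N t \<in> sign_class_power A r" if "t \<in> {0..1}" for t
    unfolding N_def using in_class sgn_\<Phi> that by blast
  have ev_N: "eigenvalue (map_mat complex_of_real (N t)) x \<longleftrightarrow> (\<Sum>k\<le>n. of_real (e k t) * (- x) ^ k) = 0" for t x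
    unfolding e_def by (rule eigenvalue_iff_minor_sum[OF Nc])
  have N1: "N 1 = M"
    unfolding N_def F(1)
  proof (rule alternating_prod_cong)
    fix i assume i: "i \<in> {1..2 * r}"
    then have "F i \<in> carrier_mat n m"
      using F(2) A by (auto simp: sign_class_def)
    then show "factors n m (\<Phi> 1) i = F i"
      using i by (auto simp: factors_def \<Phi>_def in_range_def)
  qed
  have N0: "N 0 = alternating_prod n (\<lambda>_. A) r"
    unfolding N_def using A
    by (intro alternating_prod_cong eq_matI) (auto simp: factors_def \<Phi>_def in_range_def)
  have "continuous_on {0..1} (\<lambda>t. \<Phi> t c)" for c
    unfolding \<Phi>_def by (cases "in_range c") (auto intro!: continuous_intros)
  then have cont: "continuous_on {0..1} (e k)" for k
    unfolding e_def N_def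
    by (intro continuous_on_minor_sum continuous_on_alternating_prod)
  have e_top: "e n t = 1" for t
    by (simp add: e_def minor_sum_top)
  \<comment> \<open>The whole path stays in one orthant, on which each coefficient is multi-affine
    and nonnegative.\<close>
  have zero: "e k s = 0" if "e k t = 0" "t \<in> {0..1}" "s \<in> {0..1}" for k s t
  proof -
    have "minor_sum n k (alternating_prod n (factors n m (\<Phi> s)) r) = 0"
    proof (rule multiaffine_nonneg_zero[where \<sigma> = \<sigma> and \<Phi> = "\<Phi> t"
          and f = "\<lambda>\<Phi>. minor_sum n k (alternating_prod n (factors n m \<Phi>) r)"])
      show "minor_sum n k (alternating_prod n (factors n m \<Psi>) r) \<ge> 0"
        if "\<And>c. sgn (\<Psi> c) = \<sigma> c" for \<Psi>
        using in_class[OF that] P0[OF r] by (intro minor_sum_nonneg alternating_prod_carrier[of _ _ _ m]) auto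
      have "{c. \<Phi> t c \<noteq> \<Phi> s c} \<subseteq> {1..2 * r} \<times> {..<n} \<times> {..<m}"
        by (auto simp: \<Phi>_def in_range_def split: if_splits)
      then show "finite {c. \<Phi> t c \<noteq> \<Phi> s c}"
        by (rule finite_subset) auto
    qed (use that sgn_\<Phi> minor_sum_alternating_prod_affine in \<open>auto simp: e_def N_def\<close>)
    then show ?thesis by (simp add: e_def N_def)
  qed
  \<comment> \<open>The multiplicity of the eigenvalue \<open>0\<close>; by \<open>zero\<close> it
    is the same along the whole path, so after division by \<open>x ^ j0\<close> the constant term
    never vanishes.\<close>
  define j0 where "j0 = (LEAST j. e j 0 \<noteq> 0)"
  have j0: "e j0 0 \<noteq> 0" "j0 \<le> n"
    using LeastI[of "\<lambda>j. e j 0 \<noteq> 0" n] Least_le[of "\<lambda>j. e j 0 \<noteq> 0" n] e_top[of 0]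
    by (simp_all add: j0_def)
  have e_low: "e j t = 0" if "j < j0" "t \<in> {0..1}" for j t
    using not_less_Least[of j "\<lambda>j. e j 0 \<noteq> 0"] that zero[of j 0 t] by (auto simp: j0_def)
  define d where "d = n - j0"
  have factor: "(\<Sum>k\<le>n. of_real (e k t) * x ^ k) = x ^ j0 * (\<Sum>j\<le>d. of_real (e (j + j0) t) * x ^ j)"
    if "t \<in> {0..1}" for t and x :: complex
  proof -
    have "(\<Sum>k\<le>n. of_real (e k t) * x ^ k) = (\<Sum>k\<in>{j0..n}. of_real (e k t) * x ^ k)"
      using that e_low by (intro sum.mono_neutral_right) (auto simp: not_le)
    also have "\<dots> = (\<Sum>j\<in>{0..d}. of_real (e (j + j0) t) * x ^ (j + j0))"
      using sum.shift_bounds_cl_nat_ivl[of "\<lambda>k. of_real (e k t) * x ^ k" 0 j0 d] j0(2)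
      by (simp add: d_def)
    finally show ?thesis
      by (simp add: sum_distrib_left power_add ac_simps atMost_atLeast0)
  qed
  \<comment> \<open>In the variable \<open>x = - z\<close> the nonnegative eigenvalues become
    \<open>neg_axis\<close>. The set \<open>sector\<close> is the closed complement of the open
    sector around it, where \<open>eigenvalue_sector\<close> puts all remaining roots.\<close>
  define neg_axis where "neg_axis = {x. Im x = 0 \<and> Re x \<le> 0}"
  define sector where "sector = {x. - Re x \<le> cos (pi / (real n + 1)) * cmod x}"
  have root: "eigenvalue (map_mat complex_of_real (N t)) (- x)"
    if "t \<in> {0..1}" "(\<Sum>j\<le>d. of_real (e (j + j0) t) * x ^ j) = 0" for t x
    using that factor[OF that(1), of x] by (simp add: ev_N)
  have "- z \<in> neg_axis"
  proof (rule monic_poly_roots_path[where D = sector and d = d and e = "\<lambda>j. e (j + j0)"])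
    show "closed neg_axis"
      unfolding neg_axis_def Collect_conj_eq
      by (intro closed_Int closed_Collect_eq closed_Collect_le continuous_intros)
    show "closed sector"
      unfolding sector_def by (intro closed_Collect_le continuous_intros)
    show "neg_axis \<inter> sector \<subseteq> {0}"
    proof
      fix x assume x: "x \<in> neg_axis \<inter> sector"
      \<comment> \<open>On \<open>neg_axis\<close> the modulus is \<open>- Re x\<close>, so a cosine
        strictly below 1 leaves only \<open>x = 0\<close>.\<close>
      have "cos (pi / (real n + 1)) < cos 0"
        using n by (intro cos_monotone_0_pi) (auto simp: field_simps)
      moreover have "cmod x = - Re x"
        using x by (auto simp: neg_axis_def cmod_def)
      then have "cmod x \<le> cos (pi / (real n + 1)) * cmod x"
        using x by (simp add: sector_def)
      ultimately have "cmod x \<le> 0"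
        by (simp add: mult_le_cancel_right1)
      then show "x \<in> {0}" by simp
    qed
    show "neg_axis \<noteq> {}" by (auto simp: neg_axis_def intro!: exI[of _ 0])
    show "x \<in> neg_axis \<union> sector"
      if "t \<in> {0..1}" "(\<Sum>j\<le>d. of_real (e (j + j0) t) * x ^ j) = 0" for t x
      using eigenvalue_sector[OF A n P0 N_class[OF that(1)] r root[OF that]]
      by (auto simp: neg_axis_def sector_def complex_is_Real_iff)
    show "x \<in> neg_axis" if "(\<Sum>j\<le>d. of_real (e (j + j0) 0) * x ^ j) = 0" for x
    proof -
      have "eigenvalue (map_mat complex_of_real (N 0)) (- x)"
        using root[of 0 x] that by simp
      moreover obtain k K where "K \<in> carrier_mat n k" "N 0 = K * transpose_mat K"
        using alternating_prod_const_gram[OF A] N0 by metis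
      ultimately show ?thesis
        using eigenvalue_gram_mat[of K n k "- x"] by (auto simp: neg_axis_def complex_is_Real_iff)
    qed
    show "(\<Sum>j\<le>d. of_real (e (j + j0) 1) * (- z) ^ j) = 0"
      using ev False factor[of 1 "- z"] ev_N[of 1 z] N1 by simp
    show "e (0 + j0) t \<noteq> 0" if "t \<in> {0..1}" for t
      using zero[of j0 t 0] j0 that by auto
  qed (use cont e_top j0(2) in \<open>auto simp: d_def\<close>)
  then show ?thesis
    by (auto simp: neg_axis_def complex_is_Real_iff)
qed simp

theorem theorem7:
  fixes A :: "real mat" and n m :: nat
  assumes "A \<in> carrier_mat n m"
    and "\<And>r :: nat. r \<ge> 1 \<Longrightarrow> sign_class_power A r \<subseteq> P0_matrices"
  shows "\<forall>r :: nat. r \<ge> 1 \<longrightarrow> sign_class_power A r \<subseteq> PS_matrices"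
proof (intro allI impI subsetI)
  fix r M assume r: "(r :: nat) \<ge> 1" and M: "M \<in> sign_class_power A r"
  then show "M \<in> PS_matrices"
    using sign_class_power_eigenvalue_nonneg[OF assms r M] sign_class_power_carrier[OF assms(1) M]
    by (auto simp: PS_matrices_def)
qed

end
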